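(* Let $n,s\in\mathbb{N}_0$ and let $\kappa\in\mathbb{R}$ with $|\kappa|>0$. (1) Define $c_{-1}=0$, $c_0=1$ and $c_j=\prod_{l=0}^{j-1}\frac{2(n+s-l)}{\kappa}$ for $j>0$. If $s\ge 1$, then \[ \begin{aligned} I_1(n,n+1+2s,\kappa,t)=&-\sum_{j=2}^{n}\frac{c_{n-j}}{\kappa}t^jJ_{j+2s,\kappa}(t)-\left(\frac{c_{n-1}}{\kappa}+\frac{c_n}{2s}\right)tJ_{2s+1,\kappa}(t)\\ &-c_n\sum_{j=1}^{s-1}\frac{2j+1}{2j(j+1)}\,tJ_{2j+1,\kappa}(t)-\frac{c_n}{2}\,tJ_{1,\kappa}(t)-\frac{c_n}{\kappa}J_{0,\kappa}(t), \end{aligned} \] and if $s=0$, then \[ I_1(n,n+1,\kappa,t)=-\sum_{j=1}^{n}\frac{c_{n-j}}{\kappa}t^jJ_{j,\kappa}(t)-\frac{c_n}{\kappa}J_{0,\kappa}(t). \] (2) Define $c_{-1}=0$, $c_0=1$ and $c_j=\prod_{l=0}^{j-1}\frac{2(n+s-l)-1}{\kappa}$ for $j>0$. If $s\ge 1$, then \[ \begin{aligned} I_1(n,n+2s,\kappa,t)=&-\sum_{j=2}^{n}\frac{c_{n-j}}{\kappa}t^jJ_{j+2s-1,\kappa}(t)-\left(\frac{c_{n-1}}{\kappa}+\frac{c_n}{2s-1}\right)tJ_{2s,\kappa}(t)\\ &-c_n\sum_{j=1}^{s-1}\frac{4j}{4j^2-1}\,tJ_{2j,\kappa}(t)-c_n\,tJ_{0,\kappa}(t)+c_n\,I_1(0,0,\kappa,t),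 \end{aligned} \] and if $s=0$, then \[ I_1(n,n,\kappa,t)=-\sum_{j=1}^{n}\frac{c_{n-j}}{\kappa}t^jJ_{j-1,\kappa}(t)+c_n\,I_1(0,0,\kappa,t). \]
   Context: $\mathbb{N}_0=\{0,1,2,\dots\}$. $J_m$ is the Bessel function of the first kind of integer order $m$, and $J_{m,\kappa}(t):=J_m(\kappa t)$ for real $t$. $I_1(n,m,\kappa,t):=\int t^nJ_m(\kappa t)\,dt$ denotes the indefinite integral (an antiderivative in $t$ of $t^nJ_m(\kappa t)$); identities between indefinite integrals are understood up to an additive constant. Empty sums are $0$. *)

theory Defs
  imports "HOL-Analysis.Analysis"
begin

text \<open>
  The Bessel function of the first kind of integer order, by its power series.
  The reciprocal Gamma function vanishes at the nonpositive integers, so for negative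
  orders the terms with a negative exponent drop out and the series covers all of
  \<open>\<int>\<close>.
\<close>

definition bessel_J :: "int \<Rightarrow> real \<Rightarrow> real" where
  "bessel_J m x =
     (\<Sum>k. (-1) ^ k * rGamma (of_int (int k + m + 1)) / fact k * (x / 2) powi (2 * int k + m))"

definition bessel_JK :: "int \<Rightarrow> real \<Rightarrow> real \<Rightarrow> real" where
  "bessel_JK m \<kappa> t = bessel_J m (\<kappa> * t)"

text \<open>
  An indefinite integral is the set of all antiderivatives on the real line, and an identity
  between indefinite integrals up to an additive constant is an equality with the class of
  a function modulo constants.
\<close>

definition indefinite_integral :: "(real \<Rightarrow> real) \<Rightarrow> (real \<Rightarrow> real) set" where
  "indefinite_integral f = {F. \<forall>t. (F has_real_derivative f t) (at t)}"

definition plus_const :: "(real \<Rightarrow> real) \<Rightarrow> (real \<Rightarrow> real) set" where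
  "plus_const F = {(\<lambda>t. F t + C) | C. True}"

definition I1 :: "nat \<Rightarrow> int \<Rightarrow> real \<Rightarrow> (real \<Rightarrow> real) set" where
  "I1 n m \<kappa> = indefinite_integral (\<lambda>t. t ^ n * bessel_J m (\<kappa> * t))"

definition coeff_odd :: "nat \<Rightarrow> nat \<Rightarrow> real \<Rightarrow> int \<Rightarrow> real" where
  "coeff_odd n s \<kappa> j =
     (if j < 0 then 0 else \<Prod>l<nat j. 2 * (real n + real s - real l) / \<kappa>)"

definition coeff_even :: "nat \<Rightarrow> nat \<Rightarrow> real \<Rightarrow> int \<Rightarrow> real" where
  "coeff_even n s \<kappa> j =
     (if j < 0 then 0 else \<Prod>l<nat j. (2 * (real n + real s - real l) - 1) / \<kappa>)"

lemma bessel_J_nat: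
  "bessel_J (int m) x = (\<Sum>k. (-1) ^ k / (fact k * fact (k + m)) * (x / 2) ^ (2 * k + m))"
proof -
  have "rGamma (of_int (int k + int m + 1)) = (1 / fact (k + m) :: real)" for k
  proof -
    have "(of_int (int k + int m + 1) :: real) = 1 + of_nat (k + m)" by simp
    then show ?thesis by (simp only: rGamma_inverse_Gamma Gamma_fact inverse_eq_divide)
  qed
  moreover have "(x / 2) powi (2 * int k + int m) = (x / 2) ^ (2 * k + m)" for k
  proof -
    have "2 * int k + int m = int (2 * k + m)" by simp
    then show ?thesis by (simp only: power_int_of_nat)
  qed
  ultimately show ?thesis by (simp add: bessel_J_def mult.commute)
qed

lemma summable_bessel_coeffs:
  "summable (\<lambda>k. (-1) ^ k / (fact k * fact (k + m)) * y ^ k :: real)"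
proof (rule summable_comparison_test')
  show "summable (\<lambda>k. inverse (fact k) * \<bar>y\<bar> ^ k)"
    by (rule summable_exp)
  show "norm ((-1) ^ k / (fact k * fact (k + m)) * y ^ k :: real)
          \<le> inverse (fact k) * \<bar>y\<bar> ^ k" for k
  proof -
    have "(1::real) \<le> fact (k + m)" by simp
    then have "1 / (fact k * fact (k + m)) \<le> (inverse (fact k) :: real)"
      by (simp add: field_simps)
    then have "1 / (fact k * fact (k + m)) * \<bar>y\<bar> ^ k \<le> inverse (fact k) * \<bar>y\<bar> ^ k"
      by (rule mult_right_mono) simp
    then show ?thesis
      by (simp add: abs_mult power_abs)
  qed
qed

lemma bessel_J_sums:
  "(\<lambda>k. (-1) ^ k / (fact k * fact (k + m)) * (x / 2) ^ (2 * k + m)) sums bessel_J (int m) x"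
  and bessel_J_powser:
  "bessel_J (int m) x =
     (x / 2) ^ m * (\<Sum>k. (-1) ^ k / (fact k * fact (k + m)) * ((x / 2)\<^sup>2) ^ k)"
proof -
  let ?a = "\<lambda>k. (-1) ^ k / (fact k * fact (k + m)) :: real"
  have "(\<lambda>k. (x / 2) ^ m * (?a k * ((x / 2)\<^sup>2) ^ k)) sums
          ((x / 2) ^ m * (\<Sum>k. ?a k * ((x / 2)\<^sup>2) ^ k))"
    by (intro sums_mult summable_sums summable_bessel_coeffs)
  moreover have "(x / 2) ^ m * (?a k * ((x / 2)\<^sup>2) ^ k) = ?a k * (x / 2) ^ (2 * k + m)" for k
    unfolding power_add power_mult by (rule mult.left_commute [THEN trans]) (simp only: mult.commute)
  ultimately have *: "(\<lambda>k. ?a k * (x / 2) ^ (2 * k + m)) sums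
          ((x / 2) ^ m * (\<Sum>k. ?a k * ((x / 2)\<^sup>2) ^ k))"
    by (simp only:)
  then show "bessel_J (int m) x = (x / 2) ^ m * (\<Sum>k. ?a k * ((x / 2)\<^sup>2) ^ k)"
    unfolding bessel_J_nat by (rule sums_unique[symmetric])
  with * show "(\<lambda>k. ?a k * (x / 2) ^ (2 * k + m)) sums bessel_J (int m) x"
    by (simp only:)
qed

lemma isCont_bessel_J: "isCont (bessel_J (int m)) x"
proof -
  define g where "g y = (\<Sum>k. (-1) ^ k / (fact k * fact (k + m)) * y ^ k :: real)" for y
  have "bessel_J (int m) = (\<lambda>x. (x / 2) ^ m * g ((x / 2)\<^sup>2))"
    by (intro ext) (unfold g_def, rule bessel_J_powser)
  moreover have "isCont g y" for y
    unfolding g_def by (rule isCont_powser_converges_everywhere) (rule summable_bessel_coeffs)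
  then have "isCont (\<lambda>x. g ((x / 2)\<^sup>2)) x"
    by (rule isCont_o2[rotated]) (intro continuous_intros, simp)
  then have "isCont (\<lambda>x. (x / 2) ^ m * g ((x / 2)\<^sup>2)) x"
    by (intro continuous_intros) simp_all
  ultimately show ?thesis by (simp only:)
qed

text \<open>Antiderivatives exist, so quantifying over \<open>I1\<close> is not vacuous for nonnegative orders.\<close>

lemma I1_nonempty: "I1 n (int m) \<kappa> \<noteq> {}"
proof -
  have "isCont (\<lambda>t. bessel_J (int m) (\<kappa> * t)) t" for t
    by (rule isCont_o2[where g = "bessel_J (int m)"])
      (auto intro!: continuous_intros isCont_bessel_J)
  then have "isCont (\<lambda>t. t ^ n * bessel_J (int m) (\<kappa> * t)) t" for t
    by (intro continuous_intros)
  then have "\<exists>F. \<forall>t::real. - \<infinity> < ereal t \<longrightarrow> ereal t < \<infinity> \<longrightarrow>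
      (F has_vector_derivative (t ^ n * bessel_J (int m) (\<kappa> * t))) (at t)"
    by (intro einterval_antiderivative) auto
  then show ?thesis
    by (auto simp: I1_def indefinite_integral_def has_real_derivative_iff_has_vector_derivative)
qed

end

theory Submission
  imports Defs
begin

text \<open>
  Both parts of the theorem are one calculation, read at orders of different parity.
  Differentiating \<open>t ^ (n + 1) * J\<^sub>m(\<kappa> t)\<close> and using \<open>x * J\<^sub>m'(x) = m * J\<^sub>m(x) - x * J\<^sub>m\<^sub>+\<^sub>1(x)\<close> turns an
  antiderivative of \<open>t ^ n * J\<^sub>m(\<kappa> t)\<close> into one of \<open>t ^ (n + 1) * J\<^sub>m\<^sub>+\<^sub>1(\<kappa> t)\<close>
  (\<open>I1_Suc\<close>). The power and the order move together, so after \<open>n\<close> such steps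
  the power is gone and only the integral of a single Bessel function of order \<open>q\<close> is left; the
  factors collected on the way multiply to the coefficients \<open>c\<close> (\<open>I1_power_reduction\<close>).

  For that remaining integral, \<open>2 * J\<^sub>m\<^sub>+\<^sub>1' = J\<^sub>m - J\<^sub>m\<^sub>+\<^sub>2\<close> lowers the order by two, and the three-term
  recurrence trades the boundary term \<open>J\<^sub>m\<^sub>+\<^sub>1\<close> for \<open>J\<^sub>m\<close> and \<open>J\<^sub>m\<^sub>+\<^sub>2\<close>, so that only orders of one
  parity occur (\<open>I1_order_step\<close>). In the sum of these boundary terms, every
  intermediate order is met twice, which produces the weights
  \<open>1 / (2 * j + p - 1) + 1 / (2 * j + p + 1)\<close> of \<open>I1_order_reduction\<close>. The descent ends at order \<open>p = 1\<close>, whose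
  integral is \<open>- J\<^sub>0(\<kappa> t) / \<kappa>\<close>, or at order \<open>p = 0\<close>, whose integral is left as it is.
\<close>

section \<open>Derivatives and recurrences of Bessel functions\<close>

text \<open>
  The entire function with \<open>J\<^sub>m(x) = (x / 2) ^ m * bessel_series m ((x / 2)\<^sup>2)\<close>. Its
  derivative and recurrence are free of negative powers, so the identities for \<open>J\<^sub>m\<close> obtained from them
  hold at \<open>0\<close> without a separate argument.
\<close>

definition bessel_series :: "nat \<Rightarrow> real \<Rightarrow> real" where
  "bessel_series m y = (\<Sum>k. (-1) ^ k / (fact k * fact (k + m)) * y ^ k)"

lemma bessel_J_eq_series: "bessel_J (int m) x = (x / 2) ^ m * bessel_series m ((x / 2)\<^sup>2)"
  unfolding bessel_series_def by (rule bessel_J_powser)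

lemma bessel_series_deriv:
  "(bessel_series m has_real_derivative - bessel_series (Suc m) y) (at y)"
proof -
  let ?a = "\<lambda>k. (-1) ^ k / (fact k * fact (k + m)) :: real"
  have "((\<lambda>y. \<Sum>k. ?a k * y ^ k) has_real_derivative (\<Sum>k. diffs ?a k * y ^ k)) (at y)"
    by (rule termdiffs_strong_converges_everywhere) (rule summable_bessel_coeffs)
  moreover have "diffs ?a k = - ((-1) ^ k / (fact k * fact (k + Suc m)))" for k
    by (simp add: diffs_def divide_simps)
  ultimately show ?thesis
    using summable_bessel_coeffs[of "Suc m" y]
    by (simp add: bessel_series_def[abs_def] suminf_minus)
qed

lemma bessel_series_recurrence:
  "bessel_series m y = real (Suc m) * bessel_series (Suc m) y - y * bessel_series (Suc (Suc m)) y"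
proof -
  let ?a = "\<lambda>m k. (-1) ^ k / (fact k * fact (k + m)) * y ^ k :: real"
  have sums: "?a i sums bessel_series i y" for i
    unfolding bessel_series_def by (rule summable_sums) (rule summable_bessel_coeffs)
  \<comment> \<open>Multiplication by \<open>y\<close> shifts the last series by one index; its new zeroth term vanishes.\<close>
  let ?b = "\<lambda>k. if k = 0 then 0 else y * ?a (Suc (Suc m)) (k - 1)"
  have "(\<lambda>k. ?b (Suc k)) sums (y * bessel_series (Suc (Suc m)) y)"
    using sums_mult[OF sums[of "Suc (Suc m)"], of y] by simp
  then have "?b sums (y * bessel_series (Suc (Suc m)) y)"
    by (subst (asm) sums_Suc_iff) simp
  then have "(\<lambda>k. real (Suc m) * ?a (Suc m) k - ?b k) sums
      (real (Suc m) * bessel_series (Suc m) y - y * bessel_series (Suc (Suc m)) y)"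
    by (intro sums_diff sums_mult sums)
  moreover have "real (Suc m) * ?a (Suc m) k - ?b k = ?a m k" for k
  proof (cases k)
    case 0
    then show ?thesis by simp
  next
    case (Suc i)
    have "fact (Suc (Suc (i + m))) = real (Suc (Suc (i + m))) * fact (Suc (i + m))"
      and "fact (Suc i) = real (Suc i) * fact i"
      by (rule fact_Suc)+
    then show ?thesis
      using Suc by (simp add: divide_simps del: fact_Suc) (simp add: algebra_simps)
  qed
  ultimately show ?thesis
    using sums[of m] by (simp add: sums_unique2)
qed

text \<open>
  For \<open>m = 0\<close> the first summand vanishes with its factor \<open>m\<close>, whatever the truncated exponent \<open>m - 1\<close> is.
\<close>

lemma bessel_J_deriv_series:
  "(bessel_J (int m) has_real_derivative
      real m / 2 * (x / 2) ^ (m - 1) * bessel_series m ((x / 2)\<^sup>2) - bessel_J (int (Suc m)) x) (at x)"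
proof -
  have "((\<lambda>x. bessel_series m ((x / 2)\<^sup>2)) has_real_derivative
      - bessel_series (Suc m) ((x / 2)\<^sup>2) * (x / 2)) (at x)"
    by (rule DERIV_chain2[OF bessel_series_deriv]) (auto intro!: derivative_eq_intros)
  then have "((\<lambda>x. (x / 2) ^ m * bessel_series m ((x / 2)\<^sup>2)) has_real_derivative
      real m / 2 * (x / 2) ^ (m - 1) * bessel_series m ((x / 2)\<^sup>2)
        - (x / 2) ^ Suc m * bessel_series (Suc m) ((x / 2)\<^sup>2)) (at x)"
    by (auto intro!: derivative_eq_intros)
  then show ?thesis
    by (simp only: bessel_J_eq_series[abs_def])
qed

text \<open>
  The recurrence of the series makes the sum of two neighbours of \<open>J\<^sub>m\<^sub>+\<^sub>1\<close> a multiple of \<open>J\<^sub>m\<^sub>+\<^sub>1(x) / x\<close>, here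
  written without the division.
\<close>

lemma bessel_J_neighbours:
  "bessel_J (int m) x + bessel_J (int (Suc (Suc m))) x =
     real (Suc m) * (x / 2) ^ m * bessel_series (Suc m) ((x / 2)\<^sup>2)"
  unfolding bessel_J_eq_series bessel_series_recurrence[of m]
  by (simp add: algebra_simps power2_eq_square)

lemma bessel_J_recurrence:
  "x * (bessel_J (int m) x + bessel_J (int (Suc (Suc m))) x) = 2 * real (Suc m) * bessel_J (int (Suc m)) x"
  unfolding bessel_J_neighbours bessel_J_eq_series[of "Suc m"] by simp

lemma bessel_J_0_deriv: "(bessel_J 0 has_real_derivative - bessel_J 1 x) (at x)"
  using bessel_J_deriv_series[of 0 x] by simp

lemma bessel_J_Suc_deriv:
  "(bessel_J (int (Suc m)) has_real_derivative
      (bessel_J (int m) x - bessel_J (int (Suc (Suc m))) x) / 2) (at x)"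
proof -
  have "real (Suc m) / 2 * (x / 2) ^ (Suc m - 1) * bessel_series (Suc m) ((x / 2)\<^sup>2)
      - bessel_J (int (Suc (Suc m))) x =
      (bessel_J (int m) x - bessel_J (int (Suc (Suc m))) x) / 2"
    using bessel_J_neighbours[of m x] by (simp add: field_simps)
  then show ?thesis
    using bessel_J_deriv_series[of "Suc m" x] by (simp only:)
qed

text \<open>
  Solved for the derivative, \<open>x * J\<^sub>m'(x) = m * J\<^sub>m(x) - x * J\<^sub>m\<^sub>+\<^sub>1(x)\<close> says nothing at \<open>x = 0\<close>. Multiplied by
  \<open>x\<close> it holds everywhere, and in a reduction of positive powers of \<open>t\<close> that factor is always at hand.
\<close>

lemma bessel_J_deriv_raise:
  obtains D where "(bessel_J (int m) has_real_derivative D) (at x)"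
    and "x * D = real m * bessel_J (int m) x - x * bessel_J (int (Suc m)) x"
proof
  let ?D = "real m / 2 * (x / 2) ^ (m - 1) * bessel_series m ((x / 2)\<^sup>2) - bessel_J (int (Suc m)) x"
  show "(bessel_J (int m) has_real_derivative ?D) (at x)"
    by (rule bessel_J_deriv_series)
  show "x * ?D = real m * bessel_J (int m) x - x * bessel_J (int (Suc m)) x"
    unfolding bessel_J_eq_series[of m]
    by (cases m) (simp_all add: algebra_simps del: of_nat_Suc)
qed

section \<open>Antiderivatives\<close>

lemma indefinite_integral_eq_plus_const:
  assumes "F \<in> indefinite_integral f"
  shows "indefinite_integral f = plus_const F"
proof (intro equalityI subsetI)
  fix G assume "G \<in> indefinite_integral f"
  then have "((\<lambda>t. G t - F t) has_real_derivative 0) (at t)" for t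
    using assms unfolding indefinite_integral_def
    by (auto intro!: derivative_eq_intros)
  then have "G t - F t = G 0 - F 0" for t
    by (intro DERIV_isconst_all[of "\<lambda>t. G t - F t"]) blast
  then have "G = (\<lambda>t. F t + (G 0 - F 0))"
    by (intro ext) (metis add.commute diff_add_cancel)
  then show "G \<in> plus_const F"
    unfolding plus_const_def by blast
next
  fix G assume "G \<in> plus_const F"
  then show "G \<in> indefinite_integral f"
    using assms unfolding indefinite_integral_def plus_const_def
    by (auto intro!: derivative_eq_intros)
qed

lemma I1_eq_plus_const: "F \<in> I1 n m \<kappa> \<Longrightarrow> I1 n m \<kappa> = plus_const F"
  unfolding I1_def by (rule indefinite_integral_eq_plus_const)

lemma I1_iff:
  "F \<in> I1 n m \<kappa> \<longleftrightarrow> (\<forall>t. (F has_real_derivative t ^ n * bessel_JK m \<kappa> t) (at t))"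
  by (simp add: I1_def indefinite_integral_def bessel_JK_def)

lemma I1_cong:
  "F \<in> I1 n m \<kappa> \<Longrightarrow> (\<And>t. F t = G t) \<Longrightarrow> m = m' \<Longrightarrow> G \<in> I1 n m' \<kappa>"
  by (metis ext)

section \<open>Reduction of the power\<close>

text \<open>
  By \<open>bessel_J_deriv_raise\<close>, the derivative of \<open>t ^ (n + 1) * J\<^sub>m(\<kappa> t)\<close> is
  \<open>(n + 1 + m) * t ^ n * J\<^sub>m(\<kappa> t) - \<kappa> * t ^ (n + 1) * J\<^sub>m\<^sub>+\<^sub>1(\<kappa> t)\<close>.
\<close>

lemma I1_Suc:
  assumes "\<kappa> \<noteq> 0" and "F \<in> I1 n (int m) \<kappa>"
  shows "(\<lambda>t. - (t ^ Suc n * bessel_JK (int m) \<kappa> t / \<kappa>) + real (n + m + 1) / \<kappa> * F t)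
    \<in> I1 (Suc n) (int (Suc m)) \<kappa>"
  unfolding I1_iff
proof
  fix t
  obtain D where D: "(bessel_J (int m) has_real_derivative D) (at (\<kappa> * t))"
    and raise: "\<kappa> * t * D = real m * bessel_J (int m) (\<kappa> * t) - \<kappa> * t * bessel_J (int (Suc m)) (\<kappa> * t)"
    by (rule bessel_J_deriv_raise)
  have "((\<lambda>t. bessel_JK (int m) \<kappa> t) has_real_derivative D * \<kappa>) (at t)"
    unfolding bessel_JK_def
    by (rule DERIV_chain2[where g = "\<lambda>t. \<kappa> * t", OF D]) (auto intro!: derivative_eq_intros)
  moreover have "((\<lambda>t. t ^ Suc n) has_real_derivative real (Suc n) * t ^ n) (at t)"
    using DERIV_pow[of "Suc n" t] by simp
  moreover have "(F has_real_derivative t ^ n * bessel_JK (int m) \<kappa> t) (at t)"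
    using assms(2) by (simp add: I1_iff)
  ultimately have deriv: "((\<lambda>t. - (t ^ Suc n * bessel_JK (int m) \<kappa> t / \<kappa>) + real (n + m + 1) / \<kappa> * F t)
      has_real_derivative
      - ((real (Suc n) * t ^ n * bessel_JK (int m) \<kappa> t + D * \<kappa> * t ^ Suc n) / \<kappa>)
        + real (n + m + 1) / \<kappa> * (t ^ n * bessel_JK (int m) \<kappa> t)) (at t)"
    by (intro DERIV_add DERIV_minus DERIV_cdivide DERIV_mult DERIV_cmult)
  have raised: "D * \<kappa> * t ^ Suc n =
      t ^ n * (real m * bessel_J (int m) (\<kappa> * t) - \<kappa> * t * bessel_J (int (Suc m)) (\<kappa> * t))"
    unfolding raise[symmetric] by simp
  have "- ((real (Suc n) * t ^ n * bessel_JK (int m) \<kappa> t + D * \<kappa> * t ^ Suc n) / \<kappa>)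
        + real (n + m + 1) / \<kappa> * (t ^ n * bessel_JK (int m) \<kappa> t)
      = t ^ Suc n * bessel_JK (int (Suc m)) \<kappa> t"
    unfolding raised using assms(1) by (simp add: bessel_JK_def field_simps)
  with deriv show "((\<lambda>t. - (t ^ Suc n * bessel_JK (int m) \<kappa> t / \<kappa>) + real (n + m + 1) / \<kappa> * F t)
      has_real_derivative t ^ Suc n * bessel_JK (int (Suc m)) \<kappa> t) (at t)"
    by (simp only:)
qed

text \<open>
  The product of the last \<open>j\<close> factors that \<open>I1_Suc\<close> contributes on the way from \<open>J\<^sub>q\<close>
  to \<open>t ^ n * J\<^sub>n\<^sub>+\<^sub>q\<close>. An odd \<open>q = 2 * s + 1\<close> and an even \<open>q = 2 * s\<close> give the
  coefficients of the two parts of the theorem.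
\<close>

definition power_coeff :: "nat \<Rightarrow> nat \<Rightarrow> real \<Rightarrow> int \<Rightarrow> real" where
  "power_coeff n q \<kappa> j =
     (if j < 0 then 0 else \<Prod>l<nat j. (2 * (real n - real l) + real q - 1) / \<kappa>)"

lemma coeff_odd_eq: "coeff_odd n s = power_coeff n (2 * s + 1)"
  by (intro ext) (simp add: coeff_odd_def power_coeff_def algebra_simps)

lemma coeff_even_eq: "coeff_even n s = power_coeff n (2 * s)"
  by (intro ext) (simp add: coeff_even_def power_coeff_def algebra_simps)

lemma power_coeff_0 [simp]: "power_coeff n q \<kappa> 0 = 1"
  and power_coeff_neg [simp]: "j < 0 \<Longrightarrow> power_coeff n q \<kappa> j = 0"
  by (simp_all add: power_coeff_def)

lemma power_coeff_Suc:
  "power_coeff (Suc n) q \<kappa> (int (Suc j)) = real (2 * n + q + 1) / \<kappa> * power_coeff n q \<kappa> (int j)"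
proof -
  have "(\<Prod>l<Suc j. (2 * (real (Suc n) - real l) + real q - 1) / \<kappa>) =
      real (2 * n + q + 1) / \<kappa> * (\<Prod>l<j. (2 * (real n - real l) + real q - 1) / \<kappa>)"
    by (simp add: prod.lessThan_Suc_shift add.commute del: prod.lessThan_Suc)
  then show ?thesis
    by (simp only: power_coeff_def nat_int of_nat_less_0_iff if_False)
qed

lemma I1_power_reduction:
  assumes "\<kappa> \<noteq> 0" and "F \<in> I1 0 (int q) \<kappa>"
  shows "(\<lambda>t. - (\<Sum>j=1..n. power_coeff n q \<kappa> (int n - int j) / \<kappa> * t ^ j
                        * bessel_JK (int j + int q - 1) \<kappa> t)
            + power_coeff n q \<kappa> (int n) * F t) \<in> I1 n (int n + int q) \<kappa>"
proof (induction n)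
  case 0
  then show ?case using assms(2) by simp
next
  case (Suc n)
  define S where "S n t = (\<Sum>j=1..n. power_coeff n q \<kappa> (int n - int j) / \<kappa> * t ^ j
                        * bessel_JK (int j + int q - 1) \<kappa> t)" for n t
  let ?r = "real (2 * n + q + 1) / \<kappa>"
  have S_Suc: "S (Suc n) t = ?r * S n t + t ^ Suc n * bessel_JK (int (n + q)) \<kappa> t / \<kappa>" for t
  proof -
    have "power_coeff (Suc n) q \<kappa> (int (Suc n) - int j) = ?r * power_coeff n q \<kappa> (int n - int j)"
      if "j \<in> {1..n}" for j
      using that power_coeff_Suc[of n q \<kappa> "n - j"] by (simp add: of_nat_diff algebra_simps)
    then have "(\<Sum>j=1..n. power_coeff (Suc n) q \<kappa> (int (Suc n) - int j) / \<kappa> * t ^ j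
                        * bessel_JK (int j + int q - 1) \<kappa> t) = ?r * S n t"
      unfolding S_def sum_distrib_left by (intro sum.cong) (simp_all del: of_nat_Suc)
    then show ?thesis by (simp add: S_def)
  qed
  have "(\<lambda>t. - S n t + power_coeff n q \<kappa> (int n) * F t) \<in> I1 n (int (n + q)) \<kappa>"
    using Suc by (simp add: S_def)
  from I1_Suc[OF assms(1) this]
  show ?case
    unfolding S_def[symmetric] S_Suc power_coeff_Suc
    by (rule I1_cong) (simp_all add: algebra_simps add_divide_distrib diff_divide_distrib del: power_Suc)
qed

section \<open>Reduction of the order\<close>

lemma I1_order_step:
  assumes "\<kappa> \<noteq> 0" and "F \<in> I1 0 (int m) \<kappa>"
  shows "(\<lambda>t. F t - t * (bessel_JK (int m) \<kappa> t + bessel_JK (int (m + 2)) \<kappa> t) / real (m + 1))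
    \<in> I1 0 (int (m + 2)) \<kappa>"
proof -
  \<comment> \<open>The same function with the boundary term that \<open>2 * J\<^sub>m\<^sub>+\<^sub>1' = J\<^sub>m - J\<^sub>m\<^sub>+\<^sub>2\<close> produces.\<close>
  have "((\<lambda>t. F t - 2 / \<kappa> * bessel_J (int (Suc m)) (\<kappa> * t)) has_real_derivative
      bessel_JK (int (m + 2)) \<kappa> t) (at t)" for t
  proof -
    have "((\<lambda>t. bessel_J (int (Suc m)) (\<kappa> * t)) has_real_derivative
        (bessel_J (int m) (\<kappa> * t) - bessel_J (int (Suc (Suc m))) (\<kappa> * t)) / 2 * \<kappa>) (at t)"
      by (rule DERIV_chain2[where g = "\<lambda>t. \<kappa> * t", OF bessel_J_Suc_deriv]) (auto intro!: derivative_eq_intros)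
    moreover have "(F has_real_derivative bessel_JK (int m) \<kappa> t) (at t)"
      using assms(2) by (simp add: I1_iff)
    ultimately have "((\<lambda>t. F t - 2 / \<kappa> * bessel_J (int (Suc m)) (\<kappa> * t)) has_real_derivative
        bessel_JK (int m) \<kappa> t - 2 / \<kappa> * ((bessel_J (int m) (\<kappa> * t)
          - bessel_J (int (Suc (Suc m))) (\<kappa> * t)) / 2 * \<kappa>)) (at t)"
      by (intro DERIV_diff DERIV_cmult)
    then show ?thesis
      using assms(1) by (simp add: bessel_JK_def add.commute diff_divide_distrib)
  qed
  moreover have "2 / \<kappa> * bessel_J (int (Suc m)) (\<kappa> * t) =
      t * (bessel_JK (int m) \<kappa> t + bessel_JK (int (m + 2)) \<kappa> t) / real (m + 1)" for t
    using bessel_J_recurrence[of "\<kappa> * t" m] assms(1)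
    by (simp add: bessel_JK_def divide_simps add.commute) (simp add: algebra_simps)
  ultimately show ?thesis
    by (simp add: I1_iff)
qed

text \<open>
  Starting at \<open>s = 1\<close> keeps the denominators \<open>2 * j + p - 1\<close> positive for \<open>p = 0\<close> too. Raising \<open>s\<close> adds
  \<open>1 / (2 * s + p + 1)\<close> to the weight \<open>1 / (2 * s + p - 1)\<close> of order \<open>2 * s + p\<close>, which makes that
  order one more term of the sum.
\<close>

lemma I1_order_reduction:
  assumes "\<kappa> \<noteq> 0" and "H \<in> I1 0 (int p) \<kappa>" and "s \<ge> 1"
  shows "(\<lambda>t. H t - t * bessel_JK (int (2 * s + p)) \<kappa> t / (2 * real s + real p - 1)
      - (\<Sum>j=1..s-1. (1 / (2 * real j + real p - 1) + 1 / (2 * real j + real p + 1)) * t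
            * bessel_JK (int (2 * j + p)) \<kappa> t)
      - t * bessel_JK (int p) \<kappa> t / (real p + 1)) \<in> I1 0 (int (2 * s + p)) \<kappa>"
  using \<open>s \<ge> 1\<close>
proof (induction s rule: nat_induct_at_least)
  case base
  show ?case
    using I1_order_step[OF assms(1,2)]
    by (simp add: algebra_simps add_divide_distrib)
next
  case (Suc s)
  then obtain k where k: "s = Suc k"
    by (metis not0_implies_Suc not_one_le_zero)
  show ?case
    using I1_order_step[OF assms(1) Suc.IH]
    by (simp add: k algebra_simps add_divide_distrib)
qed

section \<open>The combined reduction\<close>

text \<open>
  The power reduction with \<open>q = 2 * s + p\<close>, applied to the antiderivative from the order reduction. Its
  term \<open>j = 1\<close> and the leading boundary term of the order reduction are both multiples of
  \<open>t * J\<^sub>q(\<kappa> t)\<close> and are merged.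
\<close>

lemma I1_reduction:
  fixes n p s :: nat and \<kappa> :: real
  assumes "\<kappa> \<noteq> 0" and "H \<in> I1 0 (int p) \<kappa>" and "s \<ge> 1"
  defines "c \<equiv> power_coeff n (2 * s + p) \<kappa>"
  shows "(\<lambda>t. - (\<Sum>j=2..n. c (int n - int j) / \<kappa> * t ^ j
                    * bessel_JK (int j + int (2 * s + p) - 1) \<kappa> t)
      - (c (int n - 1) / \<kappa> + c (int n) / (2 * real s + real p - 1)) * t
          * bessel_JK (int (2 * s + p)) \<kappa> t
      - c (int n) * (\<Sum>j=1..s-1. (1 / (2 * real j + real p - 1) + 1 / (2 * real j + real p + 1)) * t
            * bessel_JK (int (2 * j + p)) \<kappa> t)
      - c (int n) / (real p + 1) * t * bessel_JK (int p) \<kappa> t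
      + c (int n) * H t) \<in> I1 n (int n + int (2 * s + p)) \<kappa>"
proof -
  \<comment> \<open>For \<open>n = 0\<close> there is no term \<open>j = 1\<close> to split off, and \<open>c (-1) = 0\<close> makes up for it.\<close>
  have split: "(\<Sum>j=1..n. c (int n - int j) / \<kappa> * t ^ j * bessel_JK (int j + int (2 * s + p) - 1) \<kappa> t) =
      c (int n - 1) / \<kappa> * t * bessel_JK (int (2 * s + p)) \<kappa> t
      + (\<Sum>j=2..n. c (int n - int j) / \<kappa> * t ^ j * bessel_JK (int j + int (2 * s + p) - 1) \<kappa> t)" for t
    by (cases "n = 0") (simp_all add: c_def sum.atLeast_Suc_atMost[of "Suc 0" n] numeral_2_eq_2)
  from I1_power_reduction[OF assms(1) I1_order_reduction[OF assms(1-3)], of n, folded c_def]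
  show ?thesis
    unfolding split by (rule I1_cong) (simp_all add: algebra_simps)
qed

lemma neg_bessel_J_0_in_I1:
  assumes "\<kappa> \<noteq> 0"
  shows "(\<lambda>t. - (bessel_JK 0 \<kappa> t / \<kappa>)) \<in> I1 0 (int 1) \<kappa>"
  unfolding I1_iff
proof
  fix t
  have "((\<lambda>t. bessel_J 0 (\<kappa> * t)) has_real_derivative - bessel_J 1 (\<kappa> * t) * \<kappa>) (at t)"
    by (rule DERIV_chain2[where g = "\<lambda>t. \<kappa> * t", OF bessel_J_0_deriv]) (auto intro!: derivative_eq_intros)
  from DERIV_minus[OF DERIV_cdivide[OF this, of \<kappa>]]
  show "((\<lambda>t. - (bessel_JK 0 \<kappa> t / \<kappa>)) has_real_derivative t ^ 0 * bessel_JK (int 1) \<kappa> t) (at t)"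
    using assms by (simp add: bessel_JK_def)
qed

theorem proposition2p8:
  fixes n s :: nat and \<kappa> :: real
  assumes "\<bar>\<kappa>\<bar> > 0"
  shows
    "(let c = coeff_odd n s \<kappa>; N = int n; S = int s in
       (s \<ge> 1 \<longrightarrow>
          I1 n (N + 1 + 2 * S) \<kappa> = plus_const (\<lambda>t.
            - (\<Sum>j=2..n. c (N - int j) / \<kappa> * t ^ j * bessel_JK (int j + 2 * S) \<kappa> t)
            - (c (N - 1) / \<kappa> + c N / (2 * real s)) * t * bessel_JK (2 * S + 1) \<kappa> t
            - c N * (\<Sum>j=1..s-1. (2 * real j + 1) / (2 * real j * (real j + 1)) * t
                                   * bessel_JK (2 * int j + 1) \<kappa> t)
            - c N / 2 * t * bessel_JK 1 \<kappa> t
            - c N / \<kappa> * bessel_JK 0 \<kappa> t)) \<and>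
       (s = 0 \<longrightarrow>
          I1 n (N + 1) \<kappa> = plus_const (\<lambda>t.
            - (\<Sum>j=1..n. c (N - int j) / \<kappa> * t ^ j * bessel_JK (int j) \<kappa> t)
            - c N / \<kappa> * bessel_JK 0 \<kappa> t)))
     \<and>
     (let c = coeff_even n s \<kappa>; N = int n; S = int s in
       \<forall>G \<in> I1 0 0 \<kappa>.
         (s \<ge> 1 \<longrightarrow>
            I1 n (N + 2 * S) \<kappa> = plus_const (\<lambda>t.
              - (\<Sum>j=2..n. c (N - int j) / \<kappa> * t ^ j * bessel_JK (int j + 2 * S - 1) \<kappa> t)
              - (c (N - 1) / \<kappa> + c N / (2 * real s - 1)) * t * bessel_JK (2 * S) \<kappa> t
              - c N * (\<Sum>j=1..s-1. 4 * real j / (4 * (real j)\<^sup>2 - 1) * t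
                                     * bessel_JK (2 * int j) \<kappa> t)
              - c N * t * bessel_JK 0 \<kappa> t
              + c N * G t)) \<and>
         (s = 0 \<longrightarrow>
            I1 n N \<kappa> = plus_const (\<lambda>t.
              - (\<Sum>j=1..n. c (N - int j) / \<kappa> * t ^ j * bessel_JK (int j - 1) \<kappa> t)
              + c N * G t)))"
proof -
  have \<kappa>: "\<kappa> \<noteq> 0" using assms by simp
  have "1 / (2 * real j + real 1 - 1) + 1 / (2 * real j + real 1 + 1) =
      (2 * real j + 1) / (2 * real j * (real j + 1))" if "j \<in> {1..s-1}" for j
    using that by (simp add: divide_simps) (simp add: algebra_simps)
  then have sum_odd: "(\<Sum>j=1..s-1. (1 / (2 * real j + real 1 - 1) + 1 / (2 * real j + real 1 + 1)) * t
          * bessel_JK (int (2 * j + 1)) \<kappa> t) =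
      (\<Sum>j=1..s-1. (2 * real j + 1) / (2 * real j * (real j + 1)) * t
          * bessel_JK (2 * int j + 1) \<kappa> t)" for t
    by (intro sum.cong refl) (simp only: of_nat_add of_nat_mult of_nat_numeral of_nat_1)
  have "1 / (2 * real j + real 0 - 1) + 1 / (2 * real j + real 0 + 1) =
      4 * real j / (4 * (real j)\<^sup>2 - 1)" if "j \<in> {1..s-1}" for j
  proof -
    have "4 * (real j)\<^sup>2 - 1 = (2 * real j - 1) * (2 * real j + 1)"
      by (simp add: power2_eq_square algebra_simps)
    moreover have "2 * real j - 1 \<noteq> 0" "2 * real j + 1 \<noteq> 0"
      using that by auto
    ultimately show ?thesis
      by (simp add: divide_simps)
  qed
  then have sum_even: "(\<Sum>j=1..s-1. (1 / (2 * real j + real 0 - 1) + 1 / (2 * real j + real 0 + 1)) * t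
          * bessel_JK (int (2 * j + 0)) \<kappa> t) =
      (\<Sum>j=1..s-1. 4 * real j / (4 * (real j)\<^sup>2 - 1) * t * bessel_JK (2 * int j) \<kappa> t)" for t
    by (intro sum.cong refl) (simp only: of_nat_mult of_nat_numeral add_0_right)
  show ?thesis
    unfolding Let_def coeff_odd_eq coeff_even_eq
  proof (intro conjI impI ballI I1_eq_plus_const, goal_cases)
    case 1
    show ?case
      by (rule I1_cong[OF I1_reduction[OF \<kappa> neg_bessel_J_0_in_I1[OF \<kappa>] 1, of n, unfolded sum_odd]])
        (simp_all add: algebra_simps)
  next
    case 2
    then show ?case
      by (intro I1_cong[OF I1_power_reduction[OF \<kappa> neg_bessel_J_0_in_I1[OF \<kappa>], of n]]) simp_all
  next
    case (3 G)
    then have "G \<in> I1 0 (int 0) \<kappa>" by simp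
    from I1_reduction[OF \<kappa> this 3(2), of n, unfolded sum_even]
    show ?case
      by (rule I1_cong) (simp_all add: algebra_simps)
  next
    case (4 G)
    then have "G \<in> I1 0 (int 0) \<kappa>" by simp
    from I1_power_reduction[OF \<kappa> this, of n]
    show ?case
      by (rule I1_cong) (simp_all add: 4(2))
  qed
qed

end
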